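(* Let $X \in \mathcal{COP}(p)$ and $P=\{1,\dots,p\}$. I. Suppose that a set $\emptyset\neq \overline P\subset P$ satisfies the following two conditions: (A) $\operatorname{rank}(X(\overline P))=|\overline P|-1$; (B) there exists $\bar t=(\bar t_k, k\in\overline P)$ such that $X(\overline P)\bar t=\mathbf 0$, $\bar t>\mathbf 0$, $\|\bar t\|_1=1$. Then the vector $\bar\tau=(\bar\tau_k, k\in P)$ with $\bar\tau_k=\bar t_k$ for $k\in\overline P$ and $\bar\tau_k=0$ for $k\in P\setminus\overline P$ is a normalized minimal zero of $X$. II. Let $\bar\tau=(\bar\tau_k,k\in P)$ be a minimal zero of $X$. Then the set $\overline P:=\operatorname{supp}(\bar\tau)$ satisfies conditions (A) and (B).
   Context: Let $p\ge 2$ be an integer. $\mathcal{COP}(p)$ is the cone of copositive matrices: real symmetric $p\times p$ matrices $X$ with $t^\top Xt\ge 0$ for all $t\in\mathbb R^p$, $t\ge \mathbf 0$ (componentwise). For $t\ge\mathbf 0$, $\operatorname{supp}(t)=\{k: t_k>0\}$. A zero of $X$ is a vector $\tau\ge\mathbf 0$, $\tau\neq\mathbf 0$, with $\tau^\top X\tau=0$; it is normalized if $\|\tau\|_1=1$. A zero $\tau$ is minimal if there is no zero $t$ of $X$ with $\operatorname{supp}(t)$ a strict subset of $\operatorname{supp}(\tau)$. For $\overline P\subset P$, $X(\overline P)=(X_{kq})_{k,q\in\overline P}$ is the principal submatrix of $X$ indexed by $\overline P$. The notation $\bar t>\mathbf 0$ means that all components are positive. The symbol $\subset$ allows equality. 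*)

theory Defs
  imports "Jordan_Normal_Form.DL_Rank_Submatrix"
begin

text \<open>
  Matrices and vectors are those of \<^theory>\<open>Jordan_Normal_Form.Matrix\<close>, so indices are
  0-based and the index set of the rows and columns is \<open>{0..<p}\<close> instead of \<open>{1,...,p}\<close>.
  The order on vectors is the componentwise one.
\<close>

definition COP :: "nat \<Rightarrow> real mat set" where
  "COP p = {X \<in> carrier_mat p p. transpose_mat X = X \<and>
     (\<forall>t \<in> carrier_vec p. 0\<^sub>v p \<le> t \<longrightarrow> 0 \<le> t \<bullet> (X *\<^sub>v t))}"

definition supp :: "real vec \<Rightarrow> nat set" where
  "supp t = {k. k < dim_vec t \<and> t $ k > 0}"

definition l1_norm :: "real vec \<Rightarrow> real" where
  "l1_norm t = (\<Sum>k < dim_vec t. \<bar>t $ k\<bar>)"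

definition is_zero :: "real mat \<Rightarrow> real vec \<Rightarrow> bool" where
  "is_zero X \<tau> \<longleftrightarrow> \<tau> \<in> carrier_vec (dim_row X) \<and> 0\<^sub>v (dim_row X) \<le> \<tau> \<and>
     \<tau> \<noteq> 0\<^sub>v (dim_row X) \<and> \<tau> \<bullet> (X *\<^sub>v \<tau>) = 0"

definition normalized :: "real vec \<Rightarrow> bool" where
  "normalized \<tau> \<longleftrightarrow> l1_norm \<tau> = 1"

definition minimal_zero :: "real mat \<Rightarrow> real vec \<Rightarrow> bool" where
  "minimal_zero X \<tau> \<longleftrightarrow> is_zero X \<tau> \<and> \<not> (\<exists>t. is_zero X t \<and> supp t \<subset> supp \<tau>)"

definition principal_submatrix :: "real mat \<Rightarrow> nat set \<Rightarrow> real mat" where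
  "principal_submatrix X P = submatrix X P P"

text \<open>
  A vector \<open>(t\<^sub>k, k \<in> P)\<close> is encoded as a vector of dimension \<open>card P\<close>, listing its components in
  increasing order of \<open>k\<close>; this is also how \<^const>\<open>submatrix\<close> arranges its rows and columns.
  Hence \<open>k \<in> P\<close> is found at position \<open>card {j \<in> P. j < k}\<close>.
\<close>

definition extend_by_zero :: "nat \<Rightarrow> nat set \<Rightarrow> real vec \<Rightarrow> real vec" where
  "extend_by_zero p P t = vec p (\<lambda>k. if k \<in> P then t $ card {j \<in> P. j < k} else 0)"

lemma extend_by_zero_pick:
  assumes "P \<subseteq> {0..<p}" and "i < card P"
  shows "extend_by_zero p P t $ pick P i = t $ i"
proof -
  have "pick P i \<in> P" using assms(2) by (rule pick_in_set_le)
  moreover from this have "pick P i < p" using assms(1) by auto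
  moreover have "card {j \<in> P. j < pick P i} = i" using assms(2) by (rule card_pick_le)
  ultimately show ?thesis by (simp add: extend_by_zero_def)
qed

text \<open>The integer coercions prevent the truncation of \<open>card P - 1\<close> for empty \<open>P\<close>.\<close>

definition cond_A :: "real mat \<Rightarrow> nat set \<Rightarrow> bool" where
  "cond_A X P \<longleftrightarrow>
     int (vec_space.rank (card P) (principal_submatrix X P)) = int (card P) - 1"

definition cond_B_vec :: "real mat \<Rightarrow> nat set \<Rightarrow> real vec \<Rightarrow> bool" where
  "cond_B_vec X P t \<longleftrightarrow> t \<in> carrier_vec (card P) \<and>
     principal_submatrix X P *\<^sub>v t = 0\<^sub>v (card P) \<and>
     (\<forall>i < card P. t $ i > 0) \<and> l1_norm t = 1"

definition cond_B :: "real mat \<Rightarrow> nat set \<Rightarrow> bool" where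
  "cond_B X P \<longleftrightarrow> (\<exists>t. cond_B_vec X P t)"

end

theory Submission
  imports Defs "Jordan_Normal_Form.Matrix_Kernel"
begin

text \<open>
  Extension by zero identifies the nonnegative vectors indexed by \<open>P\<close> with those supported in \<open>P\<close>
  and preserves the quadratic form, so everything happens inside the copositive matrix
  \<open>Y = X(P)\<close>. A positive vector can be perturbed in every direction and stays nonnegative;
  hence a positive zero \<open>t\<close> of \<open>Y\<close> is a local minimum of the quadratic form, which forces
  \<open>Y t = 0\<close>, and then \<open>Y\<close> is positive semidefinite, so that all its zeros lie in its kernel.

  By rank-nullity, condition (A) says that this kernel is the line spanned by \<open>t\<close>. In that case no
  zero supported in \<open>P\<close> vanishes at an index of \<open>P\<close>, so \<open>t\<close> is minimal. Conversely, if the kernel contains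
  some \<open>u\<close> that is not a multiple of \<open>t\<close>, then moving from \<open>t\<close> along \<open>\<plusminus>u\<close>
  until the first component vanishes yields a zero of smaller support.
\<close>

section \<open>Rank-nullity and one-dimensional kernels\<close>

lemma (in vec_space) span_cols_eq_image:
  assumes A: "A \<in> carrier_mat n nc"
  shows "span (set (cols A)) = (*\<^sub>v) A ` carrier_vec nc"
proof -
  have len: "length (cols A) = nc" and dims: "\<forall>w \<in> set (cols A). dim_vec w = n"
    using A cols_dim[of A] by auto
  have lc: "lincomb_list c (cols A) = A *\<^sub>v vec nc c" for c
    using lincomb_list_as_mat_mult[OF dims, of c] mat_of_cols_cols[of A] A len by (simp del: mat_of_cols_cols)
  have "span (set (cols A)) = {lincomb_list c (cols A) | c. True}"
    using span_list_as_span[of "cols A"] cols_dim[of A] A by (auto simp: span_list_def)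
  also have "\<dots> = (*\<^sub>v) A ` carrier_vec nc"
  proof -
    have "\<exists>c. v = vec nc c" if "v \<in> carrier_vec nc" for v :: "'a vec"
      using that by (intro exI[of _ "($) v"]) auto
    then show ?thesis unfolding lc by (fastforce simp: image_iff)
  qed
  finally show ?thesis .
qed

lemma (in kernel) rank_nullity:
  "vec_space.rank nr A + dim = nc"
proof -
  interpret W: vec_space "TYPE('a)" nr .
  interpret T: linear_map class_ring NC.V W.V "(*\<^sub>v) A"
  proof
    show "(*\<^sub>v) A \<in> LinearCombinations.module_hom class_ring NC.V W.V"
      using A
      by (auto simp: LinearCombinations.module_hom_def module_vec_simps class_ring_simps mult_add_distrib_mat_vec[OF A] mult_mat_vec[OF A])
  qed
  \<comment> \<open>The rank is defined as the dimension of the span of the columns. Identifying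
    that span with the image turns rank-nullity for linear maps into the statement for
    matrices.\<close>
  have im: "T.im = W.span (set (cols A))"
    unfolding T.im_def W.span_cols_eq_image[OF A] by (simp add: module_vec_simps)
  have ker: "T.ker = mat_kernel A"
    unfolding T.ker_def mat_kernel[OF A] by (simp add: module_vec_simps)
  show ?thesis
    using T.rank_nullity[OF NC.fin_dim] unfolding im ker W.rank_def NC.dim_is_n .
qed

text \<open>A single nonzero vector is linearly independent, so \<open>{t}\<close> is a basis of the
  kernel exactly when the multiples of \<open>t\<close> exhaust it.\<close>

lemma (in kernel) dim_eq_1_iff:
  assumes t: "t \<in> mat_kernel A" "t \<noteq> 0\<^sub>v nc"
  shows "dim = 1 \<longleftrightarrow> (\<forall>u \<in> mat_kernel A. \<exists>c. u = c \<cdot>\<^sub>v t)"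
proof -
  have lc: "lincomb a {t} = a t \<cdot>\<^sub>v t" for a
  proof (rule eq_vecI)
    have "lincomb a {t} \<in> mat_kernel A"
      using t(1) by (intro Ker.lincomb_closed) (auto simp: class_ring_simps)
    then show dim: "dim_vec (lincomb a {t}) = dim_vec (a t \<cdot>\<^sub>v t)"
      using mat_kernelD(1)[OF A, of "lincomb a {t}"] mat_kernelD(1)[OF A t(1)] by auto
    fix i assume "i < dim_vec (a t \<cdot>\<^sub>v t)"
    then show "lincomb a {t} $ i = (a t \<cdot>\<^sub>v t) $ i"
      using t(1) mat_kernelD(1)[OF A t(1)] by (simp add: lincomb_index)
  qed
  have li: "\<not> Ker.lin_dep {t}"
  proof (rule Ker.finite_lin_indpt2)
    fix a assume "lincomb a {t} = 0\<^sub>v nc"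
    then have "a t \<cdot>\<^sub>v t = 0\<^sub>v nc" by (simp add: lc)
    then show "\<forall>v\<in>{t}. a v = 0"
      using t mat_kernelD(1)[OF A t(1)]
      by (auto simp: class_ring_simps vec_eq_iff)
  qed (use t in auto)
  have span: "span {t} = {c \<cdot>\<^sub>v t | c. True}"
    using t(1) by (subst Ker.finite_span) (auto simp: lc class_ring_simps)
  show ?thesis
  proof
    assume "dim = 1"
    then have "basis {t}"
      using kernel_basis_exists[OF A] li t
      by (intro Ker.dim_li_is_basis) (auto simp: Ker.fin_dim_def Ker.basis_def)
    then show "\<forall>u \<in> mat_kernel A. \<exists>c. u = c \<cdot>\<^sub>v t"
      unfolding Ker.basis_def span by auto
  next
    assume *: "\<forall>u \<in> mat_kernel A. \<exists>c. u = c \<cdot>\<^sub>v t"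
    then have "basis {t}"
      using li t mat_kernel_smult[OF A t(1)] unfolding Ker.basis_def span by auto
    then show "dim = 1" using Ker.dim_basis[of "{t}"] by simp
  qed
qed

section \<open>Quadratic forms along lines\<close>

lemma linear_term_eq_0:
  fixes b q d :: real
  assumes "d > 0" and nonneg: "\<And>c. \<bar>c\<bar> \<le> d \<Longrightarrow> 0 \<le> 2 * c * b + c\<^sup>2 * q"
  shows "b = 0"
proof (rule ccontr)
  assume "b \<noteq> 0"
  \<comment> \<open>The second bound gives \<open>e * q \<le> \<bar>b\<bar>\<close>, so at
    \<open>c = - sgn b * e\<close> the linear term \<open>- 2 * e * \<bar>b\<bar>\<close> outweighs
    the quadratic one. The minimum with \<open>d\<close> keeps \<open>c\<close> in the permitted
    range.\<close>
  define e where "e = min d (\<bar>b\<bar> / (\<bar>q\<bar> + 1))"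
  have e: "e > 0" "e \<le> d" using \<open>d > 0\<close> \<open>b \<noteq> 0\<close> by (auto simp: e_def)
  have "e * (\<bar>q\<bar> + 1) \<le> \<bar>b\<bar>"
    by (subst pos_le_divide_eq[symmetric]) (auto simp: e_def)
  then have "e * q \<le> \<bar>b\<bar>" using e abs_ge_self[of q]
    by (smt (verit) mult_left_mono)
  then have "e * (e * q - 2 * \<bar>b\<bar>) < 0" using e \<open>b \<noteq> 0\<close> by (intro mult_pos_neg) auto
  moreover have "0 \<le> 2 * (- sgn b * e) * b + (- sgn b * e)\<^sup>2 * q"
    using e by (intro nonneg) (auto simp: abs_mult sgn_if)
  ultimately show False using \<open>b \<noteq> 0\<close>
    by (auto simp: sgn_if power2_eq_square algebra_simps split: if_splits)
qed

text \<open>Symmetry of \<open>Y\<close> merges the two cross terms. Along a line the form is thus a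
  polynomial in \<open>c\<close> to which \<open>linear_term_eq_0\<close> applies whenever its
  constant term is 0.\<close>

lemma quadratic_form_add_smult:
  fixes Y :: "real mat"
  assumes Y: "Y \<in> carrier_mat n n" "transpose_mat Y = Y"
    and u: "u \<in> carrier_vec n" and v: "v \<in> carrier_vec n"
  shows "(u + c \<cdot>\<^sub>v v) \<bullet> (Y *\<^sub>v (u + c \<cdot>\<^sub>v v)) =
    u \<bullet> (Y *\<^sub>v u) + 2 * c * (v \<bullet> (Y *\<^sub>v u)) + c\<^sup>2 * (v \<bullet> (Y *\<^sub>v v))"
proof -
  have Yu: "Y *\<^sub>v u \<in> carrier_vec n" and Yv: "Y *\<^sub>v v \<in> carrier_vec n"
    using mult_mat_vec_carrier[OF Y(1)] u v by auto
  have sym: "u \<bullet> (Y *\<^sub>v v) = v \<bullet> (Y *\<^sub>v u)"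
    using transpose_vec_mult_scalar[OF Y(1) v u] Y(2) comm_scalar_prod[OF Yu v] by simp
  have "Y *\<^sub>v (u + c \<cdot>\<^sub>v v) = Y *\<^sub>v u + c \<cdot>\<^sub>v (Y *\<^sub>v v)"
    using Y u v by (simp add: mult_add_distrib_mat_vec[of _ n n] mult_mat_vec[of _ n n])
  then show ?thesis
    using u v Yu Yv sym
    by (simp add: scalar_prod_add_distrib[of _ n] add_scalar_prod_distrib[of _ n]
        power2_eq_square algebra_simps)
qed

text \<open>The first-order condition at a zero that is a minimum along each line: the linear
  coefficient vanishes, and in the direction \<open>v = Y *\<^sub>v u\<close> this coefficient is
  the sum of the squares of the components of \<open>Y *\<^sub>v u\<close>.\<close>

lemma quadratic_form_local_min_kernel:
  fixes Y :: "real mat"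
  assumes Y: "Y \<in> carrier_mat n n" "transpose_mat Y = Y"
    and u: "u \<in> carrier_vec n" "u \<bullet> (Y *\<^sub>v u) = 0"
    and nonneg: "\<And>v. v \<in> carrier_vec n \<Longrightarrow>
      \<exists>d>0. \<forall>c. \<bar>c\<bar> \<le> d \<longrightarrow> 0 \<le> (u + c \<cdot>\<^sub>v v) \<bullet> (Y *\<^sub>v (u + c \<cdot>\<^sub>v v))"
  shows "Y *\<^sub>v u = 0\<^sub>v n"
proof -
  have Yu: "Y *\<^sub>v u \<in> carrier_vec n" using mult_mat_vec_carrier[OF Y(1) u(1)] .
  obtain d where d: "d > 0"
    "\<And>c. \<bar>c\<bar> \<le> d \<Longrightarrow> 0 \<le> (u + c \<cdot>\<^sub>v (Y *\<^sub>v u)) \<bullet> (Y *\<^sub>v (u + c \<cdot>\<^sub>v (Y *\<^sub>v u)))"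
    using nonneg[OF Yu] by blast
  have "(Y *\<^sub>v u) \<bullet> (Y *\<^sub>v u) = 0"
    using d u(2) by (intro linear_term_eq_0[of d _ "(Y *\<^sub>v u) \<bullet> (Y *\<^sub>v (Y *\<^sub>v u))"])
      (simp_all add: quadratic_form_add_smult[OF Y u(1) Yu])
  then have "(\<Sum>i = 0..<n. ((Y *\<^sub>v u) $ i)\<^sup>2) = 0"
    using Yu by (simp only: scalar_prod_def power2_eq_square carrier_vecD[OF Yu])
  then have "\<forall>i<n. (Y *\<^sub>v u) $ i = 0"
    by (subst (asm) sum_nonneg_eq_0_iff) auto
  then show ?thesis using Y(1) by (intro eq_vecI) (auto simp del: index_mult_mat_vec)
qed

section \<open>Moving away from a positive vector\<close>

lemma pos_vec_perturb_nonneg: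
  fixes t v :: "real vec"
  assumes t: "t \<in> carrier_vec n" "\<forall>i<n. t $ i > 0" and v: "v \<in> carrier_vec n"
  shows "\<exists>d>0. \<forall>c. \<bar>c\<bar> \<le> d \<longrightarrow> 0\<^sub>v n \<le> t + c \<cdot>\<^sub>v v"
proof -
  \<comment> \<open>Each ratio bounds the step that component \<open>i\<close> tolerates. Adding 1
    to the denominator covers \<open>v $ i = 0\<close>, and the inserted 1 keeps the set nonempty
    for \<open>n = 0\<close>.\<close>
  define d where "d = Min (insert 1 ((\<lambda>i. t $ i / (\<bar>v $ i\<bar> + 1)) ` {..<n}))"
  have "d > 0" unfolding d_def using t by (subst Min_gr_iff) (auto intro!: divide_pos_pos)
  have "\<bar>c * v $ i\<bar> \<le> t $ i" if "\<bar>c\<bar> \<le> d" "i < n" for c i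
  proof -
    have "\<bar>c\<bar> \<le> t $ i / (\<bar>v $ i\<bar> + 1)"
      using that(1) unfolding d_def by (rule order_trans) (use that(2) in \<open>auto intro!: Min_le\<close>)
    then have "\<bar>c\<bar> * (\<bar>v $ i\<bar> + 1) \<le> t $ i" by (subst (asm) pos_le_divide_eq) auto
    then show ?thesis by (simp add: abs_mult algebra_simps)
  qed
  then have "\<forall>c. \<bar>c\<bar> \<le> d \<longrightarrow> 0\<^sub>v n \<le> t + c \<cdot>\<^sub>v v"
    using t v unfolding less_eq_vec_def by (auto simp: abs_le_iff) fastforce
  then show ?thesis using \<open>d > 0\<close> by blast
qed

text \<open>Along \<open>u\<close> or \<open>- u\<close>, the walk out of the positive orthant can
  be stopped when the first component reaches 0. That \<open>c\<close> is nonzero later allows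
  solving for \<open>u\<close>.\<close>

lemma pos_vec_combination_boundary:
  fixes t u :: "real vec"
  assumes t: "t \<in> carrier_vec n" "\<forall>i<n. t $ i > 0"
    and u: "u \<in> carrier_vec n" "u \<noteq> 0\<^sub>v n"
  shows "\<exists>c. c \<noteq> 0 \<and> 0\<^sub>v n \<le> t + c \<cdot>\<^sub>v u \<and> (\<exists>i<n. (t + c \<cdot>\<^sub>v u) $ i = 0)"
proof -
  obtain k where k: "k < n" "u $ k \<noteq> 0" using u by (metis carrier_vecD eq_vecI index_zero_vec)
  \<comment> \<open>The index with the largest ratio is the one whose component vanishes first.\<close>
  define r where "r i = \<bar>u $ i\<bar> / t $ i" for i
  have "Max (r ` {..<n}) \<in> r ` {..<n}" using k by (intro Max_in) auto
  then obtain i where i: "i < n" "Max (r ` {..<n}) = r i" by auto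
  have le: "r j \<le> r i" if "j < n" for j using that i(2)[symmetric] by auto
  have "0 < r k" using k t unfolding r_def by (auto intro!: divide_pos_pos)
  then have "u $ i \<noteq> 0" using le[OF k(1)] unfolding r_def by auto
  \<comment> \<open>This cancels component \<open>i\<close> exactly. As
    \<open>\<bar>c\<bar> = 1 / r i\<close>, maximality of \<open>r i\<close> bounds the change in
    every other component \<open>j\<close> by \<open>t $ j\<close>.\<close>
  define c where "c = - t $ i / u $ i"
  have "\<bar>c * u $ j\<bar> \<le> t $ j" if "j < n" for j
  proof -
    have "\<bar>c * u $ j\<bar> = r j * t $ j / r i"
      using t i \<open>u $ i \<noteq> 0\<close> that by (auto simp: c_def r_def abs_mult field_simps)
    also have "\<dots> \<le> t $ j"
      using le[OF that] t(2) that le[OF k(1)] \<open>0 < r k\<close> by (auto simp: divide_simps mult.commute)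
    finally show ?thesis .
  qed
  then have "0\<^sub>v n \<le> t + c \<cdot>\<^sub>v u"
    using t u unfolding less_eq_vec_def by (auto simp: abs_le_iff) fastforce
  moreover have "(t + c \<cdot>\<^sub>v u) $ i = 0" "c \<noteq> 0"
    using t u i \<open>u $ i \<noteq> 0\<close> by (auto simp: c_def)
  ultimately show ?thesis using i(1) by blast
qed

section \<open>Enumerating an index set and extending by zero\<close>

lemma bij_betw_pick:
  assumes "finite P"
  shows "bij_betw (pick P) {0..<card P} P"
\<comment> \<open>The inverse of \<open>pick P\<close> is the position formula used by
  \<open>extend_by_zero\<close>.\<close>
proof (rule bij_betw_byWitness[where f' = "\<lambda>k. card {j \<in> P. j < k}"])
  show "(\<lambda>k. card {j \<in> P. j < k}) ` P \<subseteq> {0..<card P}"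
    using assms by (auto intro!: psubset_card_mono)
qed (auto simp: card_pick_le pick_in_set_le pick_card_in_set)

lemma pick_surj:
  assumes "finite P" "k \<in> P"
  obtains i where "i < card P" "k = pick P i"
proof -
  have "k \<in> pick P ` {0..<card P}"
    using bij_betw_imp_surj_on[OF bij_betw_pick[OF assms(1)]] assms(2) by simp
  then show thesis by (auto intro: that)
qed

text \<open>Transfers norms and scalar products from all indices to positions in \<open>P\<close>;
  the other terms drop out because extended vectors vanish there.\<close>

lemma sum_pick:
  fixes f :: "nat \<Rightarrow> 'a :: comm_monoid_add"
  assumes "P \<subseteq> {0..<p}" and "\<And>k. k < p \<Longrightarrow> k \<notin> P \<Longrightarrow> f k = 0"
  shows "(\<Sum>k = 0..<p. f k) = (\<Sum>i = 0..<card P. f (pick P i))"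
proof -
  have "(\<Sum>k = 0..<p. f k) = (\<Sum>k\<in>P. f k)"
    using assms by (intro sum.mono_neutral_right) auto
  also have "\<dots> = (\<Sum>i = 0..<card P. f (pick P i))"
    using bij_betw_pick[OF finite_subset[OF assms(1)]] by (intro sum.reindex_bij_betw[symmetric]) auto
  finally show ?thesis .
qed

lemma extend_by_zero_carrier [simp]: "extend_by_zero p P u \<in> carrier_vec p"
  by (simp add: extend_by_zero_def)

lemma dim_extend_by_zero [simp]: "dim_vec (extend_by_zero p P u) = p"
  by (simp add: extend_by_zero_def)

lemma extend_by_zero_outside:
  assumes "k < p" "k \<notin> P"
  shows "extend_by_zero p P u $ k = 0"
  using assms by (simp add: extend_by_zero_def)

lemma extend_by_zero_index_cases:
  assumes P: "P \<subseteq> {0..<p}" and "k < p"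
  obtains "k \<notin> P" "extend_by_zero p P u $ k = 0"
  | i where "i < card P" "k = pick P i" "extend_by_zero p P u $ k = u $ i"
proof (cases "k \<in> P")
  case True
  then obtain i where i: "i < card P" "k = pick P i"
    by (rule pick_surj[OF finite_subset[OF P finite_atLeastLessThan]])
  then show thesis by (intro that(2)) (simp_all add: extend_by_zero_pick[OF P])
next
  case False
  then show thesis using that(1) assms(2) extend_by_zero_outside by auto
qed

lemma extend_by_zero_nonneg:
  assumes P: "P \<subseteq> {0..<p}" and u: "0\<^sub>v (card P) \<le> u"
  shows "0\<^sub>v p \<le> extend_by_zero p P u"
proof -
  have "0 \<le> extend_by_zero p P u $ k" if "k < p" for k
    using P that by (rule extend_by_zero_index_cases[where u = u]) (use u in \<open>auto simp: less_eq_vec_def\<close>)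
  then show ?thesis by (simp add: less_eq_vec_def)
qed

lemma extend_by_zero_eq_0_iff:
  assumes P: "P \<subseteq> {0..<p}" and u: "u \<in> carrier_vec (card P)"
  shows "extend_by_zero p P u = 0\<^sub>v p \<longleftrightarrow> u = 0\<^sub>v (card P)"
proof
  assume *: "extend_by_zero p P u = 0\<^sub>v p"
  show "u = 0\<^sub>v (card P)"
  proof (rule eq_vecI)
    fix i assume "i < dim_vec (0\<^sub>v (card P) :: real vec)"
    then have "i < card P" by simp
    moreover from this have "pick P i < p" using pick_in_set_le P by fastforce
    ultimately show "u $ i = 0\<^sub>v (card P) $ i"
      using extend_by_zero_pick[OF P, of i u] * by simp
  qed (use u in auto)
next
  assume *: "u = 0\<^sub>v (card P)"
  have "extend_by_zero p P u $ k = 0" if "k < p" for k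
    using P that by (rule extend_by_zero_index_cases[where u = u]) (use * in auto)
  then show "extend_by_zero p P u = 0\<^sub>v p"
    by (intro eq_vecI) auto
qed

lemma supp_extend_by_zero:
  assumes P: "P \<subseteq> {0..<p}"
  shows "supp (extend_by_zero p P u) = pick P ` {i. i < card P \<and> u $ i > 0}" (is "?L = ?R")
proof
  show "?L \<subseteq> ?R"
  proof
    fix k assume "k \<in> ?L"
    then have k: "k < p" "extend_by_zero p P u $ k > 0"
      by (auto simp: supp_def)
    from P k(1) show "k \<in> ?R"
      by (rule extend_by_zero_index_cases[where u = u]) (use k(2) in auto)
  qed
  have "pick P i < p" if "i < card P" for i using pick_in_set_le[OF that] P by auto
  then show "?R \<subseteq> ?L"
    by (auto simp: supp_def extend_by_zero_pick[OF P])
qed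

text \<open>The way back from \<open>X\<close> to its principal submatrix: any zero of
  \<open>X\<close> supported in \<open>P\<close> comes from a vector indexed by
  \<open>P\<close>.\<close>

lemma extend_by_zero_restrict:
  assumes P: "P \<subseteq> {0..<p}" and \<tau>: "\<tau> \<in> carrier_vec p" "0\<^sub>v p \<le> \<tau>" "supp \<tau> \<subseteq> P"
  shows "extend_by_zero p P (vec (card P) (\<lambda>i. \<tau> $ pick P i)) = \<tau>"
proof (rule eq_vecI)
  let ?u = "vec (card P) (\<lambda>i. \<tau> $ pick P i)"
  fix k assume "k < dim_vec \<tau>"
  then have k: "k < p" using \<tau> by simp
  \<comment> \<open>\<open>supp\<close> records positive components only; nonnegativity makes the
    remaining ones 0.\<close>
  have "\<tau> $ k = 0" if "k \<notin> P" using \<tau> k that by (force simp: supp_def less_eq_vec_def)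
  with P k show "extend_by_zero p P ?u $ k = \<tau> $ k"
    by (elim extend_by_zero_index_cases[where u = ?u]) auto
qed (use \<tau> in \<open>simp add: extend_by_zero_def\<close>)

lemma l1_norm_extend_by_zero:
  assumes P: "P \<subseteq> {0..<p}" and u: "u \<in> carrier_vec (card P)"
  shows "l1_norm (extend_by_zero p P u) = l1_norm u"
  using sum_pick[OF P, of "\<lambda>k. \<bar>extend_by_zero p P u $ k\<bar>"] u
  by (simp add: l1_norm_def extend_by_zero_outside
      extend_by_zero_pick[OF P] atLeast0LessThan)

section \<open>Principal submatrices\<close>

lemma principal_submatrix_carrier:
  assumes "P \<subseteq> {0..<p}" "X \<in> carrier_mat p p"
  shows "principal_submatrix X P \<in> carrier_mat (card P) (card P)"
proof -
  have "{i. i < p \<and> i \<in> P} = P" using assms(1) by auto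
  then show ?thesis using assms(2) by (auto simp: principal_submatrix_def submatrix_def)
qed

lemma principal_submatrix_index:
  assumes "P \<subseteq> {0..<p}" "X \<in> carrier_mat p p" "i < card P" "j < card P"
  shows "principal_submatrix X P $$ (i, j) = X $$ (pick P i, pick P j)"
proof -
  have "{i. i < p \<and> i \<in> P} = P" using assms(1) by auto
  then show ?thesis using assms by (auto simp: principal_submatrix_def submatrix_def)
qed

lemma quadratic_form_extend_by_zero:
  assumes P: "P \<subseteq> {0..<p}" and X: "X \<in> carrier_mat p p" and u: "u \<in> carrier_vec (card P)"
  shows "extend_by_zero p P u \<bullet> (X *\<^sub>v extend_by_zero p P u) = u \<bullet> (principal_submatrix X P *\<^sub>v u)"
proof -
  let ?E = "extend_by_zero p P u" and ?Y = "principal_submatrix X P"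
  note Y = principal_submatrix_carrier[OF P X]
  have pick: "pick P i < p" if "i < card P" for i using pick_in_set_le[OF that] P by auto
  \<comment> \<open>The two products are compared at indices in \<open>P\<close> only. Elsewhere
    \<open>X *\<^sub>v ?E\<close> may be nonzero, but the scalar product multiplies it by a zero
    component of \<open>?E\<close>.\<close>
  have row: "(X *\<^sub>v ?E) $ pick P i = (?Y *\<^sub>v u) $ i" if i: "i < card P" for i
  proof -
    have "(X *\<^sub>v ?E) $ pick P i = (\<Sum>k = 0..<p. X $$ (pick P i, k) * ?E $ k)"
      using X pick[OF i] by (simp add: scalar_prod_def)
    also have "\<dots> = (\<Sum>j = 0..<card P. X $$ (pick P i, pick P j) * ?E $ pick P j)"
      using P by (rule sum_pick) (simp add: extend_by_zero_outside)
    also have "\<dots> = (?Y *\<^sub>v u) $ i"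
      using Y u i by (simp add: scalar_prod_def extend_by_zero_pick[OF P] principal_submatrix_index[OF P X])
    finally show ?thesis .
  qed
  have "?E \<bullet> (X *\<^sub>v ?E) = (\<Sum>k = 0..<p. ?E $ k * (X *\<^sub>v ?E) $ k)"
    using X by (simp add: scalar_prod_def)
  also have "\<dots> = (\<Sum>i = 0..<card P. ?E $ pick P i * (X *\<^sub>v ?E) $ pick P i)"
    using P by (rule sum_pick) (simp add: extend_by_zero_outside)
  also have "\<dots> = (\<Sum>i = 0..<card P. u $ i * (?Y *\<^sub>v u) $ i)"
    by (intro sum.cong) (auto simp: row extend_by_zero_pick[OF P] simp del: index_mult_mat_vec)
  also have "\<dots> = u \<bullet> (?Y *\<^sub>v u)"
    using Y by (simp add: scalar_prod_def)
  finally show ?thesis .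
qed

lemma principal_submatrix_COP:
  assumes P: "P \<subseteq> {0..<p}" and X: "X \<in> COP p"
  shows "principal_submatrix X P \<in> COP (card P)"
proof -
  have Xc: "X \<in> carrier_mat p p" and sym: "X\<^sup>T = X"
    and cop: "\<And>t. t \<in> carrier_vec p \<Longrightarrow> 0\<^sub>v p \<le> t \<Longrightarrow> 0 \<le> t \<bullet> (X *\<^sub>v t)"
    using X by (auto simp: COP_def)
  note Y = principal_submatrix_carrier[OF P Xc]
  have pick: "pick P i < p" if "i < card P" for i using pick_in_set_le[OF that] P by auto
  have "X $$ (i, j) = X $$ (j, i)" if "i < p" "j < p" for i j
    using that Xc arg_cong[OF sym, of "\<lambda>M. M $$ (i, j)"] by simp
  then have "(principal_submatrix X P)\<^sup>T = principal_submatrix X P"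
    using Y by (intro eq_matI) (auto simp: principal_submatrix_index[OF P Xc] pick)
  moreover have "0 \<le> u \<bullet> (principal_submatrix X P *\<^sub>v u)"
    if "u \<in> carrier_vec (card P)" "0\<^sub>v (card P) \<le> u" for u
    using cop[OF extend_by_zero_carrier extend_by_zero_nonneg[OF P that(2)]]
      quadratic_form_extend_by_zero[OF P Xc that(1)] by simp
  ultimately show ?thesis using Y by (auto simp: COP_def)
qed

section \<open>Positive zeros of copositive matrices\<close>

lemma COP_kernel_if_positive_zero:
  assumes Y: "Y \<in> COP n" and t: "t \<in> carrier_vec n" "\<forall>i<n. t $ i > 0" and "t \<bullet> (Y *\<^sub>v t) = 0"
  shows "Y *\<^sub>v t = 0\<^sub>v n"
proof (rule quadratic_form_local_min_kernel)
  fix v :: "real vec" assume v: "v \<in> carrier_vec n"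
  obtain d where "d > 0" "\<forall>c. \<bar>c\<bar> \<le> d \<longrightarrow> 0\<^sub>v n \<le> t + c \<cdot>\<^sub>v v"
    using pos_vec_perturb_nonneg[OF t v] by blast
  then show "\<exists>d>0. \<forall>c. \<bar>c\<bar> \<le> d \<longrightarrow> 0 \<le> (t + c \<cdot>\<^sub>v v) \<bullet> (Y *\<^sub>v (t + c \<cdot>\<^sub>v v))"
    using Y t(1) v by (auto simp: COP_def intro!: exI[of _ d])
qed (use assms in \<open>auto simp: COP_def\<close>)

text \<open>Because \<open>Y *\<^sub>v t = 0\<^sub>v n\<close>, the form at
  \<open>t + d \<cdot>\<^sub>v v\<close> is \<open>d\<^sup>2\<close> times the form at
  \<open>v\<close>, and for small positive \<open>d\<close> that point lies in the nonnegative
  orthant, where copositivity applies.\<close>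

lemma COP_psd_if_positive_kernel:
  assumes Y: "Y \<in> COP n" and t: "t \<in> carrier_vec n" "\<forall>i<n. t $ i > 0" and 0: "Y *\<^sub>v t = 0\<^sub>v n"
    and v: "v \<in> carrier_vec n"
  shows "0 \<le> v \<bullet> (Y *\<^sub>v v)"
proof -
  obtain d where d: "d > 0" "0\<^sub>v n \<le> t + d \<cdot>\<^sub>v v"
    using pos_vec_perturb_nonneg[OF t v] by (metis abs_of_pos order_refl)
  then have "0 \<le> (t + d \<cdot>\<^sub>v v) \<bullet> (Y *\<^sub>v (t + d \<cdot>\<^sub>v v))"
    using Y t(1) v by (simp add: COP_def)
  also have "\<dots> = d\<^sup>2 * (v \<bullet> (Y *\<^sub>v v))"
    using Y t(1) v 0 by (subst quadratic_form_add_smult[of _ n]) (auto simp: COP_def)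
  finally show ?thesis using d(1) by (simp add: zero_le_mult_iff)
qed

text \<open>A positive semidefinite form has a global minimum at each of its zeros, so the
  first-order condition holds at \<open>u\<close> whatever the signs of its components.\<close>

lemma COP_zero_in_kernel_if_positive_kernel:
  assumes Y: "Y \<in> COP n" and t: "t \<in> carrier_vec n" "\<forall>i<n. t $ i > 0" and 0: "Y *\<^sub>v t = 0\<^sub>v n"
    and u: "u \<in> carrier_vec n" "u \<bullet> (Y *\<^sub>v u) = 0"
  shows "Y *\<^sub>v u = 0\<^sub>v n"
proof (rule quadratic_form_local_min_kernel[OF _ _ u])
  show "\<exists>d>0. \<forall>c. \<bar>c\<bar> \<le> d \<longrightarrow> 0 \<le> (u + c \<cdot>\<^sub>v v) \<bullet> (Y *\<^sub>v (u + c \<cdot>\<^sub>v v))"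
    if "v \<in> carrier_vec n" for v
    using COP_psd_if_positive_kernel[OF Y t 0] u(1) that by (intro exI[of _ 1]) auto
qed (use Y in \<open>auto simp: COP_def\<close>)

section \<open>Condition (A) and minimal zeros\<close>

lemma cond_A_iff:
  assumes P: "P \<subseteq> {0..<p}" and X: "X \<in> carrier_mat p p"
    and t: "t \<in> carrier_vec (card P)" "t \<noteq> 0\<^sub>v (card P)" "principal_submatrix X P *\<^sub>v t = 0\<^sub>v (card P)"
  shows "cond_A X P \<longleftrightarrow> (\<forall>u \<in> carrier_vec (card P).
    principal_submatrix X P *\<^sub>v u = 0\<^sub>v (card P) \<longrightarrow> (\<exists>c. u = c \<cdot>\<^sub>v t))"
proof -
  note Y = principal_submatrix_carrier[OF P X]
  interpret kernel "card P" "card P" "principal_submatrix X P" by unfold_locales (rule Y)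
  \<comment> \<open>For a square matrix of size \<open>card P\<close>, a rank deficit of one means
    nullity one.\<close>
  have "cond_A X P \<longleftrightarrow> dim = 1" using rank_nullity unfolding cond_A_def by auto
  then show ?thesis using dim_eq_1_iff[of t] t unfolding mat_kernel[OF Y] by auto
qed

lemma minimal_zero_extend_by_zero:
  assumes X: "X \<in> COP p" and P: "P \<noteq> {}" "P \<subseteq> {0..<p}" and A: "cond_A X P" and B: "cond_B_vec X P t"
  shows "minimal_zero X (extend_by_zero p P t)"
proof -
  let ?Y = "principal_submatrix X P" and ?E = "extend_by_zero p P"
  have Xc: "X \<in> carrier_mat p p" using X by (simp add: COP_def)
  note Y = principal_submatrix_COP[OF P(2) X]
  have t: "t \<in> carrier_vec (card P)" "\<forall>i<card P. t $ i > 0" and Yt: "?Y *\<^sub>v t = 0\<^sub>v (card P)"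
    using B by (auto simp: cond_B_vec_def)
  have "finite P" using P(2) finite_subset by blast
  then have "0 < card P" using P(1) by (simp add: card_gt_0_iff)
  then have t0: "t \<noteq> 0\<^sub>v (card P)" using t(2) by force
  have suppE: "supp (?E t) = P"
  proof -
    have "{i. i < card P \<and> t $ i > 0} = {0..<card P}" using t(2) by auto
    then show ?thesis
      using bij_betw_imp_surj_on[OF bij_betw_pick[OF \<open>finite P\<close>]] by (simp add: supp_extend_by_zero[OF P(2)])
  qed
  have "0\<^sub>v (card P) \<le> t" using t by (auto simp: less_eq_vec_def less_imp_le)
  then have "is_zero X (?E t)"
    using Xc t t0 Yt extend_by_zero_nonneg[OF P(2)] unfolding is_zero_def
    by (auto simp: quadratic_form_extend_by_zero[OF P(2)] extend_by_zero_eq_0_iff[OF P(2)])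
  moreover have False if s: "is_zero X s" "supp s \<subset> P" for s
  proof -
    define u where "u = vec (card P) (\<lambda>i. s $ pick P i)"
    have u: "u \<in> carrier_vec (card P)" by (simp add: u_def)
    have sE: "s = ?E u"
      unfolding u_def using s Xc
      by (intro extend_by_zero_restrict[symmetric] P(2)) (auto simp: is_zero_def)
    have "u \<bullet> (?Y *\<^sub>v u) = 0" "u \<noteq> 0\<^sub>v (card P)"
      using s(1) Xc u by (auto simp: is_zero_def sE quadratic_form_extend_by_zero[OF P(2)]
        extend_by_zero_eq_0_iff[OF P(2)])
    \<comment> \<open>Semidefiniteness puts \<open>u\<close> into the kernel, which by (A) is the
      line through \<open>t\<close>.\<close>
    then obtain c where c: "u = c \<cdot>\<^sub>v t"
      using COP_zero_in_kernel_if_positive_kernel[OF Y t Yt u] cond_A_iff[OF P(2) Xc t(1) t0 Yt] A u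
      by blast
    \<comment> \<open>Strict inclusion of supports yields an index of \<open>P\<close> at which
      \<open>s\<close> vanishes while \<open>t\<close> is positive there, which forces
      \<open>c = 0\<close>.\<close>
    obtain k where k: "k \<in> P" "k \<notin> supp s" using s(2) by blast
    obtain i where i: "i < card P" "k = pick P i"
      by (rule pick_surj[OF \<open>finite P\<close> k(1)])
    have "dim_vec s = p" "0\<^sub>v p \<le> s" using s(1) Xc by (simp_all add: is_zero_def)
    moreover have "k < p" using k(1) P(2) by (meson atLeastLessThan_iff subsetD)
    ultimately have "0 \<le> s $ k" "s $ k \<le> 0"
      using k(2) by (simp_all add: less_eq_vec_def supp_def)
    moreover have "s $ k = c * t $ i"
      using i t(1) by (simp add: sE extend_by_zero_pick[OF P(2)] c)
    ultimately have "c = 0" using t(2) i(1) by force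
    then show False using \<open>u \<noteq> 0\<^sub>v (card P)\<close> c t(1) by auto
  qed
  ultimately show ?thesis by (auto simp: minimal_zero_def suppE)
qed

lemma minimal_zero_conds:
  assumes X: "X \<in> COP p" and min: "minimal_zero X \<tau>"
  shows "cond_A X (supp \<tau>)" and "cond_B X (supp \<tau>)"
proof -
  define P where "P = supp \<tau>"
  let ?Y = "principal_submatrix X P" and ?E = "extend_by_zero p P"
  have Xc: "X \<in> carrier_mat p p" using X by (simp add: COP_def)
  have \<tau>: "\<tau> \<in> carrier_vec p" "0\<^sub>v p \<le> \<tau>" "\<tau> \<noteq> 0\<^sub>v p" "\<tau> \<bullet> (X *\<^sub>v \<tau>) = 0"
    using min Xc by (auto simp: minimal_zero_def is_zero_def)
  have P: "P \<subseteq> {0..<p}" using \<tau>(1) by (auto simp: P_def supp_def)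
  note Y = principal_submatrix_COP[OF P X]
  note Yc = principal_submatrix_carrier[OF P Xc]
  define t where "t = vec (card P) (\<lambda>i. \<tau> $ pick P i)"
  have t: "t \<in> carrier_vec (card P)" "\<forall>i<card P. t $ i > 0"
    using pick_in_set_le[of _ P] by (auto simp: t_def P_def supp_def)
  have \<tau>E: "\<tau> = ?E t"
    unfolding t_def using \<tau> P by (intro extend_by_zero_restrict[symmetric]) (auto simp: P_def)
  have t0: "t \<noteq> 0\<^sub>v (card P)" using \<tau>(3) t(1) by (simp add: \<tau>E extend_by_zero_eq_0_iff[OF P])
  have Yt: "?Y *\<^sub>v t = 0\<^sub>v (card P)"
    using \<tau>(4) t(1) by (intro COP_kernel_if_positive_zero[OF Y t])
      (simp add: \<tau>E quadratic_form_extend_by_zero[OF P Xc])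
  define l where "l = l1_norm t"
  have "0 < card P" using t0 t(1) by (intro gr0I) auto
  then have "0 < l" unfolding l_def l1_norm_def using t by (intro sum_pos) auto
  \<comment> \<open>Scaling by a positive factor normalizes \<open>t\<close> and preserves both
    positivity and membership in the kernel.\<close>
  have "cond_B_vec X P (inverse l \<cdot>\<^sub>v t)"
    using t Yt \<open>0 < l\<close> mult_mat_vec[OF Yc t(1)]
    by (auto simp: cond_B_vec_def l1_norm_def abs_mult l_def sum_distrib_left[symmetric])
  then show "cond_B X (supp \<tau>)" unfolding cond_B_def P_def by blast
  have "\<exists>c. u = c \<cdot>\<^sub>v t" if u: "u \<in> carrier_vec (card P)" "?Y *\<^sub>v u = 0\<^sub>v (card P)" for u
  proof (cases "u = 0\<^sub>v (card P)")
    case True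
    then show ?thesis using t(1) by (intro exI[of _ 0]) auto
  next
    case False
    then obtain c i where c: "c \<noteq> 0" "0\<^sub>v (card P) \<le> t + c \<cdot>\<^sub>v u"
      and i: "i < card P" "(t + c \<cdot>\<^sub>v u) $ i = 0"
      using pos_vec_combination_boundary[OF t u(1)] by blast
    \<comment> \<open>The kernel is a linear subspace, so \<open>s\<close> stays in it. Its
      cancelled component \<open>i\<close> makes the support of \<open>?E s\<close> strictly smaller
      than that of \<open>\<tau>\<close>.\<close>
    define s where "s = t + c \<cdot>\<^sub>v u"
    have s: "s \<in> carrier_vec (card P)" using t u by (simp add: s_def)
    have "?Y *\<^sub>v s = 0\<^sub>v (card P)"
      using t u Yt Yc by (simp add: s_def mult_add_distrib_mat_vec[OF Yc] mult_mat_vec[OF Yc] vec_eq_iff)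
    then have "?E s \<bullet> (X *\<^sub>v ?E s) = 0"
      using s by (simp add: quadratic_form_extend_by_zero[OF P Xc])
    moreover have "pick P i \<in> P" "pick P i \<notin> supp (?E s)"
      using i by (auto simp: supp_def extend_by_zero_pick[OF P] s_def[symmetric] intro: pick_in_set_le)
    then have "supp (?E s) \<subset> supp \<tau>"
      by (auto simp: supp_extend_by_zero[OF P] P_def[symmetric] intro: pick_in_set_le)
    \<comment> \<open>\<open>?E s\<close> meets every requirement on a zero of \<open>X\<close>
      except possibly being nonzero, so minimality of \<open>\<tau>\<close> leaves only
      \<open>s = 0\<close>, and \<open>u\<close> is a multiple of \<open>t\<close>.\<close>
    ultimately have "s = 0\<^sub>v (card P)"
      using min s Xc extend_by_zero_nonneg[OF P c(2)] extend_by_zero_eq_0_iff[OF P s]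
      by (auto simp: minimal_zero_def is_zero_def s_def)
    then have "t $ j + c * u $ j = 0" if "j < card P" for j
      using that u t by (auto simp: s_def dest!: arg_cong[of _ _ "\<lambda>v. v $ j"])
    then have "u = (- inverse c) \<cdot>\<^sub>v t"
      using c(1) t(1) u(1) by (intro eq_vecI) (auto simp: field_simps add_eq_0_iff)
    then show ?thesis by blast
  qed
  then show "cond_A X (supp \<tau>)"
    using cond_A_iff[OF P Xc t(1) t0 Yt] by (simp add: P_def)
qed

theorem proposition1:
  fixes p :: nat and X :: "real mat"
  assumes "p \<ge> 2" and "X \<in> COP p"
  shows "(\<forall>P. P \<noteq> {} \<and> P \<subseteq> {0..<p} \<and> cond_A X P \<longrightarrow>
            (\<forall>t. cond_B_vec X P t \<longrightarrow>
               normalized (extend_by_zero p P t) \<and> minimal_zero X (extend_by_zero p P t))) \<and>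
         (\<forall>\<tau>. minimal_zero X \<tau> \<longrightarrow> cond_A X (supp \<tau>) \<and> cond_B X (supp \<tau>))"
proof -
  have "normalized (extend_by_zero p P t)" if "P \<subseteq> {0..<p}" "cond_B_vec X P t" for P t
    using that by (simp add: normalized_def cond_B_vec_def l1_norm_extend_by_zero)
  then show ?thesis
    using minimal_zero_extend_by_zero[OF assms(2)] minimal_zero_conds[OF assms(2)] by blast
qed

end
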